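(* Let $\gamma\in(0,1)$, $0<\lambda\le\Lambda$, let $L_K\in\mathcal{L}_0(n,\gamma,\lambda,\Lambda)$, and let $v$ be a bounded solution to $$\begin{cases}L_Kv=f(v)&\text{in }\mathbb{R}^n,\\ v\ge0&\text{in }\mathbb{R}^n,\end{cases}$$ with a nonlinearity $f\in C^1$ satisfying (a) $f(0)=f(1)=0$; (b) $f'(0)>0$; (c) $f>0$ in $(0,1)$, and $f<0$ in $(1,+\infty)$. Then $v\equiv0$ or $v\equiv1$.
   Context: For a kernel $K$ on $\mathbb{R}^n\setminus\{0\}$, $L_K w(x)=\int_{\mathbb{R}^n}(w(x)-w(y))K(x-y)\,dy$ (principal value sense). For $\gamma\in(0,1)$ and $0<\lambda\le\Lambda$, $L_K\in\mathcal{L}_0(n,\gamma,\lambda,\Lambda)$ means $K(z)=K(-z)$ and $\lambda c_{n,\gamma}|z|^{-n-2\gamma}\le K(z)\le\Lambda c_{n,\gamma}|z|^{-n-2\gamma}$, where $c_{n,\gamma}=\gamma\,\frac{2^{2\gamma}\Gamma(\frac n2+\gamma)}{\pi^{n/2}\Gamma(1-\gamma)}$. Solutions are understood in the classical (pointwise) sense (bounded weak solutions are classical by regularity theory). *)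

theory Defs
  imports "HOL-Analysis.Analysis"
begin

definition c_const :: "nat \<Rightarrow> real \<Rightarrow> real" where
  "c_const n \<gamma> = \<gamma> * (2 powr (2 * \<gamma>) * Gamma (real n / 2 + \<gamma>)) / (pi powr (real n / 2) * Gamma (1 - \<gamma>))"

(* A kernel on R^n minus the origin is a total function whose value at 0 is irrelevant:
   no condition below involves K 0, and the origin is a null set.
   The lower ellipticity constant is called \<mu>, lambda being reserved syntax. *)
definition kernel_class :: "real \<Rightarrow> real \<Rightarrow> real \<Rightarrow> (real ^ 'n \<Rightarrow> real) set" where
  "kernel_class \<gamma> \<mu> \<Lambda> = {K. K \<in> borel_measurable lebesgue \<and>
     (\<forall>z. z \<noteq> 0 \<longrightarrow>
        K z = K (- z) \<and>
        \<mu> * c_const CARD('n) \<gamma> * norm z powr (- real CARD('n) - 2 * \<gamma>) \<le> K z \<and>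
        K z \<le> \<Lambda> * c_const CARD('n) \<gamma> * norm z powr (- real CARD('n) - 2 * \<gamma>))}"

(* "L_K w (x) exists and equals l". The principal value removes the balls |x - y| \<le> \<epsilon>.
   Integrability is demanded explicitly, since the Bochner integral of a non-integrable
   function is 0 by convention. *)
definition has_integro_op :: "(real ^ 'n \<Rightarrow> real) \<Rightarrow> (real ^ 'n \<Rightarrow> real) \<Rightarrow> real ^ 'n \<Rightarrow> real \<Rightarrow> bool" where
  "has_integro_op K w x l \<longleftrightarrow>
     (\<forall>\<epsilon>>0. set_integrable lebesgue {y. \<epsilon> < norm (x - y)} (\<lambda>y. (w x - w y) * K (x - y))) \<and>
     ((\<lambda>\<epsilon>. set_lebesgue_integral lebesgue {y. \<epsilon> < norm (x - y)} (\<lambda>y. (w x - w y) * K (x - y)))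
        \<longlongrightarrow> l) (at_right 0)"

(* Only continuity and existence of the principal value are required; in particular
   functions of class C^{2\<gamma>+\<alpha>} solving the equation pointwise are covered. *)
definition classical_solution :: "(real ^ 'n \<Rightarrow> real) \<Rightarrow> (real \<Rightarrow> real) \<Rightarrow> (real ^ 'n \<Rightarrow> real) \<Rightarrow> bool" where
  "classical_solution K f v \<longleftrightarrow>
     continuous_on UNIV v \<and> (\<forall>x. has_integro_op K v x (f (v x)))"

end

theory Submission
  imports Defs
begin

text \<open>
  If \<open>v\<close> vanishes at a point, then \<open>L\<^sub>K v \<le> 0\<close> there with equality only for \<open>v = 0\<close>, so assume
  \<open>v > 0\<close>. Put a multiple \<open>e b\<close> of the bump \<open>b(y) = (max 0 (1 - |y - z|\<^sup>2 / R\<^sup>2))\<^sup>2\<close> below \<open>v\<close>, with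
  \<open>e\<close> maximal. At a touching point \<open>x\<close> one has \<open>f(v(x)) = L\<^sub>K v(x) \<le> e L\<^sub>K b(x) \<le> C R powr (- 2 * \<gamma>) v(x)\<close>
  with \<open>C\<close> independent of \<open>R\<close> and \<open>z\<close>. For large \<open>R\<close> this contradicts \<open>f(t) \<ge> f'(0) t / 2\<close> unless
  \<open>v(x)\<close> exceeds a fixed \<open>t\<^sub>0\<close>; then \<open>v(z) \<ge> e \<ge> v(x) \<ge> t\<^sub>0\<close>, so \<open>inf v > 0\<close>. Perturbing \<open>v\<close> by small
  bumps near almost extremal points gives \<open>f(sup v) \<ge> 0 \<ge> f(inf v)\<close>, whence
  \<open>sup v \<le> 1 \<le> inf v\<close>.
\<close>

section \<open>Reflections and symmetrised principal values\<close>

lemma distr_lebesgue_reflect: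
  fixes a :: "'a::euclidean_space"
  shows "distr lebesgue lebesgue (\<lambda>y. a - y) = lebesgue"
    and measurable_lebesgue_reflect: "(\<lambda>y. a - y) \<in> lebesgue \<rightarrow>\<^sub>M lebesgue"
proof -
  \<comment> \<open>Writes the reflection as a diagonal affine map with all factors -1, whose
    Jacobian has absolute value 1.\<close>
  have eq: "(\<lambda>x. a + (\<Sum>j\<in>Basis. (- 1 * (x \<bullet> j)) *\<^sub>R j)) = (\<lambda>y. a - y)"
    by (simp add: sum_negf euclidean_representation)
  show "(\<lambda>y. a - y) \<in> lebesgue \<rightarrow>\<^sub>M lebesgue"
    using lebesgue_affine_measurable[of "\<lambda>_. -1" a] unfolding eq by simp
  show "distr lebesgue lebesgue (\<lambda>y. a - y) = lebesgue"
    using lebesgue_affine_euclidean[of "\<lambda>_. -1" a] unfolding eq by (simp add: density_1)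
qed

lemma integral_lebesgue_reflect:
  fixes a :: "'a::euclidean_space" and f :: "'a \<Rightarrow> real"
  assumes "integrable lebesgue f"
  shows "integrable lebesgue (\<lambda>y. f (a - y))"
    and "(\<integral>y. f (a - y) \<partial>lebesgue) = (\<integral>y. f y \<partial>lebesgue)"
  using integrable_distr[OF measurable_lebesgue_reflect, of a f]
    integral_distr[OF measurable_lebesgue_reflect borel_measurable_integrable[OF assms], of a] assms
  by (simp_all add: distr_lebesgue_reflect)

text \<open>Symmetrising the principal value under \<open>y \<mapsto> 2 x - y\<close> cancels the first-order singularity,
  so a pointwise bound on the second difference of \<open>w\<close> bounds the operator.\<close>

lemma integro_op_le:
  fixes K w G :: "real ^ 'n \<Rightarrow> real"
  assumes op: "has_integro_op K w x l"
    and even: "\<And>z. z \<noteq> 0 \<Longrightarrow> K (- z) = K z" and pos: "\<And>z. z \<noteq> 0 \<Longrightarrow> 0 \<le> K z"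
    and le: "\<And>y. y \<noteq> x \<Longrightarrow> 2 * w x - w y - w (2 *\<^sub>R x - y) \<le> G y"
    and int: "integrable lebesgue (\<lambda>y. G y * K (x - y))"
  shows "2 * l \<le> (\<integral>y. G y * K (x - y) \<partial>lebesgue)"
proof -
  define S where "S = (\<lambda>\<epsilon>. {y. \<epsilon> < norm (x - y)})"
  define F where "F = (\<lambda>\<epsilon> y. indicator (S \<epsilon>) y * ((w x - w y) * K (x - y)))"
  define H where "H = (\<lambda>\<epsilon> y. indicator (S \<epsilon>) y * (G y * K (x - y)))"
  have S_meas: "S \<epsilon> \<in> sets lebesgue" for \<epsilon>
  proof -
    have "open (S \<epsilon>)" unfolding S_def by (intro open_Collect_less continuous_intros)
    then show ?thesis by auto
  qed
  have Fint: "integrable lebesgue (F \<epsilon>)" if "\<epsilon> > 0" for \<epsilon>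
    using op that unfolding has_integro_op_def F_def S_def set_integrable_def by simp
  have Hint: "integrable lebesgue (H \<epsilon>)" for \<epsilon>
    using integrable_mult_indicator[OF S_meas int, of \<epsilon>] unfolding H_def by simp
  have step: "2 * (\<integral>y. F \<epsilon> y \<partial>lebesgue) \<le> (\<integral>y. H \<epsilon> y \<partial>lebesgue)" if "\<epsilon> > 0" for \<epsilon>
  proof -
    \<comment> \<open>Reflection in \<open>x\<close> preserves Lebesgue measure and
      \<open>S \<epsilon>\<close>, so twice the truncated integral equals that of the second
      difference of \<open>w\<close> against \<open>K\<close>.\<close>
    note R = integral_lebesgue_reflect[OF Fint[OF that], of "2 *\<^sub>R x"]
    have "2 * (\<integral>y. F \<epsilon> y \<partial>lebesgue) = (\<integral>y. F \<epsilon> y + F \<epsilon> (2 *\<^sub>R x - y) \<partial>lebesgue)"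
      using R Fint[OF that] by simp
    also have "\<dots> \<le> (\<integral>y. H \<epsilon> y \<partial>lebesgue)"
    proof (rule integral_mono)
      show "F \<epsilon> y + F \<epsilon> (2 *\<^sub>R x - y) \<le> H \<epsilon> y" for y
      proof (cases "y \<in> S \<epsilon>")
        case True
        then have ne: "x - y \<noteq> 0" using that by (auto simp: S_def)
        have e: "x - (2 *\<^sub>R x - y) = - (x - y)" by (simp add: scaleR_2)
        have m: "2 *\<^sub>R x - y \<in> S \<epsilon>" using True unfolding S_def mem_Collect_eq e norm_minus_cancel .
        have "F \<epsilon> y + F \<epsilon> (2 *\<^sub>R x - y) = (2 * w x - w y - w (2 *\<^sub>R x - y)) * K (x - y)"
          using True m even[OF ne] unfolding F_def e by (simp add: algebra_simps)
        also have "\<dots> \<le> G y * K (x - y)"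
          using le[of y] pos[OF ne] ne by (intro mult_right_mono) auto
        finally show ?thesis using True by (simp add: H_def)
      next
        case False
        have e: "x - (2 *\<^sub>R x - y) = - (x - y)" by (simp add: scaleR_2)
        have m: "2 *\<^sub>R x - y \<notin> S \<epsilon>" using False unfolding S_def mem_Collect_eq e norm_minus_cancel .
        then show ?thesis using False by (simp add: F_def H_def)
      qed
    qed (use R Fint[OF that] Hint in auto)
    finally show ?thesis .
  qed
  \<comment> \<open>Dominated convergence is applied along a sequence, so the limit at 0 from the
    right is restricted to one.\<close>
  define e where "e = (\<lambda>n::nat. 1 / real (Suc n))"
  have e_lim: "filterlim e (at_right 0) sequentially"
    unfolding filterlim_at e_def using LIMSEQ_inverse_real_of_nat
    by (auto simp: inverse_eq_divide)
  have "((\<lambda>\<epsilon>. \<integral>y. F \<epsilon> y \<partial>lebesgue) \<longlongrightarrow> l) (at_right 0)"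
    using op unfolding has_integro_op_def F_def S_def set_lebesgue_integral_def by simp
  from filterlim_compose[OF this e_lim]
  have L1: "(\<lambda>n. 2 * (\<integral>y. F (e n) y \<partial>lebesgue)) \<longlonglongrightarrow> 2 * l"
    by (intro tendsto_intros)
  have L2: "(\<lambda>n. \<integral>y. H (e n) y \<partial>lebesgue) \<longlonglongrightarrow> (\<integral>y. G y * K (x - y) \<partial>lebesgue)"
  proof (rule integral_dominated_convergence)
    show "integrable lebesgue (\<lambda>y. norm (G y * K (x - y)))" using int by simp
    show "(\<lambda>y. G y * K (x - y)) \<in> borel_measurable lebesgue" using int by (rule borel_measurable_integrable)
    show "H (e n) \<in> borel_measurable lebesgue" for n using Hint by (rule borel_measurable_integrable)
    show "AE y in lebesgue. norm (H (e n) y) \<le> norm (G y * K (x - y))" for n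
      by (auto simp: H_def indicator_def)
    \<comment> \<open>\<open>H (e n) x\<close> is 0 for every \<open>n\<close>, while
      \<open>G x * K 0\<close> may be nonzero: convergence can fail at \<open>x\<close>, a null
      set.\<close>
    have ne: "AE y in lebesgue. y \<noteq> x" 
    proof (rule AE_I')
      show "{x} \<in> null_sets lebesgue" using negligible_iff_null_sets negligible_sing by blast
    qed auto
    show "AE y in lebesgue. (\<lambda>n. H (e n) y) \<longlonglongrightarrow> G y * K (x - y)"
      using ne
    proof eventually_elim
      case (elim y)
      then have "norm (x - y) > 0" by simp
      moreover have "e \<longlonglongrightarrow> 0" using e_lim unfolding filterlim_at by simp
      ultimately have "\<forall>\<^sub>F n in sequentially. e n < norm (x - y)" by (rule order_tendstoD[rotated])
      then have "\<forall>\<^sub>F n in sequentially. H (e n) y = G y * K (x - y)"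
        by eventually_elim (simp add: H_def S_def)
      then show ?case by (rule tendsto_eventually)
    qed
  qed
  show ?thesis
    by (rule LIMSEQ_le[OF L1 L2]) (use step in \<open>auto simp: e_def\<close>)
qed

section \<open>Truncated quadratics integrated against the power kernel\<close>

text \<open>The typical size of a second difference at scale \<open>r\<close>: quadratic near the
  origin, bounded far away. This is the majorant that a kernel of order 2 \<gamma> with 0 < \<gamma>
  < 1 can integrate.\<close>

definition trunc_sq :: "real \<Rightarrow> 'a::real_normed_vector \<Rightarrow> real" where
  "trunc_sq r z = min 1 ((norm z)\<^sup>2 / r\<^sup>2)"

lemma trunc_sq_nonneg: "0 \<le> trunc_sq r z"
  by (simp add: trunc_sq_def)

text \<open>Shells inside and outside radius \<open>r\<close> are indexed separately by naturals,
  because each family is later summed by its own geometric series.\<close>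

lemma dyadic_shell:
  fixes r t :: real
  assumes "0 < r" "0 < t"
  obtains j :: nat where "r * 2 powr real j \<le> t" "t \<le> 2 * (r * 2 powr real j)"
  | j :: nat where "r * 2 powr (- real j - 1) \<le> t" "t \<le> 2 * (r * 2 powr (- real j - 1))"
proof -
  define i where "i = \<lfloor>log 2 (t / r)\<rfloor>"
  have "2 powr (log 2 (t / r)) = t / r" using assms by simp
  moreover have "2 powr real_of_int i \<le> 2 powr (log 2 (t / r))"
    "2 powr (log 2 (t / r)) \<le> 2 powr (real_of_int i + 1)"
    unfolding i_def by (intro powr_mono; linarith)+
  ultimately have b: "r * 2 powr real_of_int i \<le> t" "t \<le> 2 * (r * 2 powr real_of_int i)"
    using assms by (simp_all add: powr_add field_simps)
  show ?thesis
  proof (cases "i \<ge> 0")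
    case True
    then have "real_of_int i = real (nat i)" by simp
    then show ?thesis using b that(1)[of "nat i"] by metis
  next
    case False
    then have "real_of_int i = - real (nat (- i - 1)) - 1" by simp
    then show ?thesis using b that(2)[of "nat (- i - 1)"] by metis
  qed
qed

text \<open>Summation over dyadic shells. The shell at radius \<open>s\<close> contributes a
  multiple of \<open>min 1 (4 * s\<^sup>2 / r\<^sup>2) * s powr (- 2 * \<gamma>)\<close>. The outer
  shells decay with ratio \<open>p\<close> because \<gamma> > 0, the inner ones with ratio
  \<open>q\<close> because \<gamma> < 1. \<open>C\<close> is fixed before \<open>r\<close> and
  \<open>x\<close>.\<close>

lemma nn_integral_trunc_sq_powr_le:
  fixes \<gamma> :: real
  assumes "0 < \<gamma>" "\<gamma> < 1"
  obtains C where "0 < C" "\<And>(r::real) (x::'a::euclidean_space). 0 < r \<Longrightarrow>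
    (\<integral>\<^sup>+y. ennreal (trunc_sq r (x - y) * norm (x - y) powr (- real DIM('a) - 2 * \<gamma>)) \<partial>lebesgue)
      \<le> ennreal (C * r powr (- 2 * \<gamma>))"
proof -
  define d where "d = DIM('a)"
  define B where "B = unit_ball_vol (real d) * 2 ^ d"
  have B: "B > 0" by (simp add: B_def)
  define p q where "p = (2::real) powr (- 2 * \<gamma>)" and "q = (2::real) powr (2 * \<gamma> - 2)"
  have p: "0 < p" "p < 1" and q: "0 < q" "q < 1"
    using assms unfolding p_def q_def by (auto simp: powr_less_one)
  \<comment> \<open>\<open>B\<close> is the volume of a ball of radius 2. The factor 5 absorbs
    \<open>2 powr (2 * \<gamma>)\<close>, which is at most 4, on the inner shells.\<close>
  define C where "C = 5 * B * (1 / (1 - p) + 1 / (1 - q))"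
  have "C > 0" unfolding C_def using B p q by (intro mult_pos_pos add_pos_pos) auto
  moreover have "(\<integral>\<^sup>+y. ennreal (trunc_sq r (x - y) * norm (x - y) powr (- real d - 2 * \<gamma>)) \<partial>lebesgue)
      \<le> ennreal (C * r powr (- 2 * \<gamma>))" if r: "0 < r" for r and x :: 'a
  proof -
    \<comment> \<open>On the shell between radii \<open>s\<close> and \<open>2 * s\<close> the
      truncated factor is largest at the outer radius and the power at the inner one;
      \<open>c s\<close> combines both.\<close>
    define c where "c = (\<lambda>s. min 1 (4 * s\<^sup>2 / r\<^sup>2) * s powr (- real d - 2 * \<gamma>))"
    define T where "T = (\<lambda>s y. ennreal (c s) * indicator (cball x (2 * s)) y)"
    define s1 s2 where "s1 = (\<lambda>j::nat. r * 2 powr real j)" and "s2 = (\<lambda>j::nat. r * 2 powr (- real j - 1))"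
    have spos: "s1 j > 0" "s2 j > 0" for j using r by (auto simp: s1_def s2_def)
    have c0: "c s \<ge> 0" for s by (simp add: c_def)
    have point: "ennreal (trunc_sq r (x - y) * norm (x - y) powr (- real d - 2 * \<gamma>)) \<le> T s y"
      if "0 < s" "s \<le> norm (x - y)" "norm (x - y) \<le> 2 * s" for s y
    proof -
      have "(norm (x - y))\<^sup>2 \<le> (2 * s)\<^sup>2" using that by (intro power_mono) auto
      then have "(norm (x - y))\<^sup>2 / r\<^sup>2 \<le> 4 * s\<^sup>2 / r\<^sup>2"
        by (intro divide_right_mono) (auto simp: power_mult_distrib)
      then have "trunc_sq r (x - y) * norm (x - y) powr (- real d - 2 * \<gamma>) \<le> c s"
        unfolding trunc_sq_def c_def using that assms
        by (intro mult_mono powr_mono2') (auto simp: min_def)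
      then show ?thesis using that unfolding T_def by (simp add: dist_norm ennreal_leI)
    qed
    have bound: "ennreal (trunc_sq r (x - y) * norm (x - y) powr (- real d - 2 * \<gamma>))
        \<le> (\<Sum>j. T (s1 j) y) + (\<Sum>j. T (s2 j) y)" for y
    \<comment> \<open>At the centre the integrand is 0, as \<open>trunc_sq r 0 = 0\<close>; no shell
      contains this point.\<close>
    proof (cases "x = y")
      case True
      then show ?thesis by simp
    next
      case False
      then have n: "0 < norm (x - y)" by simp
      show ?thesis
      proof (rule dyadic_shell[OF r n])
        fix j assume "r * 2 powr real j \<le> norm (x - y)" "norm (x - y) \<le> 2 * (r * 2 powr real j)"
        then have "ennreal (trunc_sq r (x - y) * norm (x - y) powr (- real d - 2 * \<gamma>)) \<le> T (s1 j) y"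
          using point[of "s1 j" y] spos(1)[of j] by (simp add: s1_def)
        also have "\<dots> = (\<Sum>i\<in>{j}. T (s1 i) y)" by simp
        also have "\<dots> \<le> (\<Sum>j. T (s1 j) y)" by (rule sum_le_suminf) auto
        finally show ?thesis by (simp add: add_increasing2)
      next
        fix j assume "r * 2 powr (- real j - 1) \<le> norm (x - y)" "norm (x - y) \<le> 2 * (r * 2 powr (- real j - 1))"
        then have "ennreal (trunc_sq r (x - y) * norm (x - y) powr (- real d - 2 * \<gamma>)) \<le> T (s2 j) y"
          using point[of "s2 j" y] spos(2)[of j] by (simp add: s2_def)
        also have "\<dots> = (\<Sum>i\<in>{j}. T (s2 i) y)" by simp
        also have "\<dots> \<le> (\<Sum>j. T (s2 j) y)" by (rule sum_le_suminf) auto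
        finally show ?thesis by (simp add: add_increasing)
      qed
    qed
    have T_meas: "T s \<in> borel_measurable lebesgue" for s
      unfolding T_def by (intro borel_measurable_times_ennreal borel_measurable_const borel_measurable_indicator) auto
    have T_int: "(\<integral>\<^sup>+y. T s y \<partial>lebesgue) = ennreal (B * (min 1 (4 * s\<^sup>2 / r\<^sup>2) * s powr (- 2 * \<gamma>)))" if "0 < s" for s
    proof -
      have "(\<integral>\<^sup>+y. T s y \<partial>lebesgue) = ennreal (c s) * emeasure lebesgue (cball x (2 * s))"
        unfolding T_def by (rule nn_integral_cmult_indicator) auto
      also have "\<dots> = ennreal (c s) * ennreal (unit_ball_vol (real d) * (2 * s) ^ d)"
        using emeasure_cball[of "2 * s" x] that unfolding d_def by simp
      also have "\<dots> = ennreal (c s * (unit_ball_vol (real d) * (2 * s) ^ d))"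
        using c0 by (simp add: ennreal_mult')
      also have "c s * (unit_ball_vol (real d) * (2 * s) ^ d)
        = B * (min 1 (4 * s\<^sup>2 / r\<^sup>2) * (s powr (- real d - 2 * \<gamma>) * s powr real d))"
        unfolding c_def B_def using that by (simp add: powr_realpow power_mult_distrib)
      also have "s powr (- real d - 2 * \<gamma>) * s powr real d = s powr (- 2 * \<gamma>)"
        by (simp flip: powr_add)
      finally show ?thesis .
    qed
    have i1: "(\<integral>\<^sup>+y. T (s1 j) y \<partial>lebesgue) \<le> ennreal (5 * B * r powr (- 2 * \<gamma>) * p ^ j)" for j
    proof -
      have "s1 j powr (- 2 * \<gamma>) = r powr (- 2 * \<gamma>) * p ^ j"
        using r by (simp add: s1_def p_def powr_mult powr_powr powr_power mult.commute)
      then have "min 1 (4 * (s1 j)\<^sup>2 / r\<^sup>2) * s1 j powr (- 2 * \<gamma>) \<le> 1 * (r powr (- 2 * \<gamma>) * p ^ j)"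
        using p by (intro mult_mono) auto
      also have "\<dots> \<le> 5 * (r powr (- 2 * \<gamma>) * p ^ j)" using p by (intro mult_right_mono) auto
      finally have "B * (min 1 (4 * (s1 j)\<^sup>2 / r\<^sup>2) * s1 j powr (- 2 * \<gamma>)) \<le> B * (5 * (r powr (- 2 * \<gamma>) * p ^ j))"
        using B by (intro mult_left_mono) auto
      then show ?thesis unfolding T_int[OF spos(1)] by (intro ennreal_leI) (simp add: mult_ac)
    qed
    have i2: "(\<integral>\<^sup>+y. T (s2 j) y \<partial>lebesgue) \<le> ennreal (5 * B * r powr (- 2 * \<gamma>) * q ^ j)" for j
    proof -
      have pw: "s2 j powr (- 2 * \<gamma>) = r powr (- 2 * \<gamma>) * 2 powr ((real j + 1) * (2 * \<gamma>))"
        using r by (simp add: s2_def powr_mult powr_powr algebra_simps)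
      have "4 * (s2 j)\<^sup>2 / r\<^sup>2 = 4 * (2 powr (- real j - 1))\<^sup>2" using r by (simp add: s2_def power_mult_distrib)
      also have "\<dots> = 2 powr 2 * 2 powr (2 * (- real j - 1))" by (simp add: powr_power mult.commute)
      also have "\<dots> = 2 powr (2 + 2 * (- real j - 1))" by (rule powr_add[symmetric])
      also have "\<dots> = 2 powr (- 2 * real j)" by simp
      finally have sq: "4 * (s2 j)\<^sup>2 / r\<^sup>2 = 2 powr (- 2 * real j)" .
      have "min 1 (4 * (s2 j)\<^sup>2 / r\<^sup>2) * s2 j powr (- 2 * \<gamma>)
        \<le> 2 powr (- 2 * real j) * (r powr (- 2 * \<gamma>) * 2 powr ((real j + 1) * (2 * \<gamma>)))"
        unfolding pw sq by (intro mult_right_mono) auto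
      also have "\<dots> = r powr (- 2 * \<gamma>) * (2 powr (2 * \<gamma>) * 2 powr (real j * (2 * \<gamma> - 2)))"
        by (simp add: powr_add[symmetric] algebra_simps)
      also have "2 powr (real j * (2 * \<gamma> - 2)) = q ^ j"
        by (simp add: q_def powr_power mult.commute)
      also have "r powr (- 2 * \<gamma>) * (2 powr (2 * \<gamma>) * q ^ j) \<le> r powr (- 2 * \<gamma>) * (5 * q ^ j)"
      proof (intro mult_left_mono mult_right_mono)
        have "2 powr (2 * \<gamma>) \<le> 2 powr (2::real)" using assms by (intro powr_mono) auto
        then show "2 powr (2 * \<gamma>) \<le> 5" by simp
      qed (use q in auto)
      finally have "B * (min 1 (4 * (s2 j)\<^sup>2 / r\<^sup>2) * s2 j powr (- 2 * \<gamma>)) \<le> B * (r powr (- 2 * \<gamma>) * (5 * q ^ j))"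
        using B by (intro mult_left_mono) auto
      then show ?thesis unfolding T_int[OF spos(2)] by (intro ennreal_leI) (simp add: mult_ac)
    qed
    have geo: "(\<Sum>j. ennreal (5 * B * r powr (- 2 * \<gamma>) * t ^ j)) = ennreal (5 * B * r powr (- 2 * \<gamma>) * (1 / (1 - t)))"
      if "0 < t" "t < 1" for t :: real
    proof -
      have "(\<lambda>j. t ^ j) sums (1 / (1 - t))" using geometric_sums[of t] that by simp
      then have "(\<lambda>j. 5 * B * r powr (- 2 * \<gamma>) * t ^ j) sums (5 * B * r powr (- 2 * \<gamma>) * (1 / (1 - t)))"
        by (rule sums_mult)
      then show ?thesis using B that by (intro suminf_ennreal_eq) auto
    qed
    have "(\<integral>\<^sup>+y. ennreal (trunc_sq r (x - y) * norm (x - y) powr (- real d - 2 * \<gamma>)) \<partial>lebesgue)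
      \<le> (\<integral>\<^sup>+y. (\<Sum>j. T (s1 j) y) + (\<Sum>j. T (s2 j) y) \<partial>lebesgue)"
      by (intro nn_integral_mono bound)
    also have "\<dots> = (\<Sum>j. \<integral>\<^sup>+y. T (s1 j) y \<partial>lebesgue) + (\<Sum>j. \<integral>\<^sup>+y. T (s2 j) y \<partial>lebesgue)"
      using T_meas by (simp add: nn_integral_add nn_integral_suminf)
    also have "\<dots> \<le> (\<Sum>j. ennreal (5 * B * r powr (- 2 * \<gamma>) * p ^ j)) + (\<Sum>j. ennreal (5 * B * r powr (- 2 * \<gamma>) * q ^ j))"
      by (intro add_mono suminf_le i1 i2) auto
    also have "\<dots> = ennreal (5 * B * r powr (- 2 * \<gamma>) * (1 / (1 - p)) + 5 * B * r powr (- 2 * \<gamma>) * (1 / (1 - q)))"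
      unfolding geo[OF p] geo[OF q] using B p q by (intro ennreal_plus[symmetric]) auto
    also have "\<dots> = ennreal (C * r powr (- 2 * \<gamma>))"
      by (simp add: C_def algebra_simps)
    finally show ?thesis .
  qed
  ultimately show ?thesis using that unfolding d_def by blast
qed

section \<open>Bump functions and their second differences\<close>

text \<open>A truncated paraboloid would have a kink at the edge of its support. Squaring makes the
  slope vanish there, so the bound on second differences also tends to 0 towards the edge.\<close>

definition bump :: "real \<Rightarrow> 'a::real_inner \<Rightarrow> real" where
  "bump r z = (max 0 (1 - (norm z)\<^sup>2 / r\<^sup>2))\<^sup>2"

lemma bump_nonneg: "0 \<le> bump r z"
  by (simp add: bump_def)

lemma bump_zero: "bump r 0 = 1"
  by (simp add: bump_def)

lemma bump_le_1: "bump r z \<le> 1"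
  by (simp add: bump_def power_le_one)

lemma continuous_on_bump: "r \<noteq> 0 \<Longrightarrow> continuous_on S (\<lambda>y. bump r (y - z))"
  unfolding bump_def by (intro continuous_intros) auto

lemma bump_pos_imp:
  assumes "0 < bump r z" "0 < r"
  shows "norm z < r" "0 < 1 - (norm z)\<^sup>2 / r\<^sup>2" "bump r z = (1 - (norm z)\<^sup>2 / r\<^sup>2)\<^sup>2"
proof -
  show u: "0 < 1 - (norm z)\<^sup>2 / r\<^sup>2"
  proof (rule ccontr)
    assume "\<not> ?thesis"
    then have "max 0 (1 - (norm z)\<^sup>2 / r\<^sup>2) = 0" by simp
    then show False using assms by (simp add: bump_def)
  qed
  then show "bump r z = (1 - (norm z)\<^sup>2 / r\<^sup>2)\<^sup>2" by (simp add: bump_def max_def)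
  have "(norm z)\<^sup>2 < r\<^sup>2" using u assms by (simp add: field_simps)
  then show "norm z < r" using assms(2) by (simp add: power_less_imp_less_base)
qed

text \<open>The tangent-line inequality for \<open>t \<mapsto> (max 0 t)\<^sup>2\<close> leaves the factor \<open>u\<close>, which is larger
  than the value \<open>u\<^sup>2\<close> of the bump itself.\<close>

lemma bump_second_difference:
  assumes "0 < bump r a" "0 < r"
  defines "u \<equiv> 1 - (norm a)\<^sup>2 / r\<^sup>2"
  shows "2 * bump r a - bump r (a + h) - bump r (a - h) \<le> 4 * u * trunc_sq r h"
proof -
  note b = bump_pos_imp[OF assms(1,2), folded u_def]
  have u1: "u \<le> 1" by (simp add: u_def)
  \<comment> \<open>Convexity: the left side is the tangent line at \<open>t = u\<close>.\<close>
  have tangent: "2 * u * t - u\<^sup>2 \<le> (max 0 t)\<^sup>2" for t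
  proof (cases "t \<ge> 0")
    case True
    then show ?thesis using sum_squares_bound[of u t] by simp
  next
    case False
    then have "u * t \<le> 0" using b by (simp add: mult_nonneg_nonpos)
    then have "2 * u * t - u\<^sup>2 \<le> 0" using zero_le_power2[of u] by linarith
    then show ?thesis using zero_le_power2[of "max 0 t"] by linarith
  qed
  \<comment> \<open>The parallelogram law removes the terms of first order in
    \<open>h\<close>.\<close>
  have sq: "(norm (a + h))\<^sup>2 + (norm (a - h))\<^sup>2 = 2 * (norm a)\<^sup>2 + 2 * (norm h)\<^sup>2"
    by (simp add: power2_norm_eq_inner inner_add_left inner_add_right inner_diff_left inner_diff_right)
  have "bump r (a + h) + bump r (a - h)
      \<ge> 2 * u * (1 - (norm (a + h))\<^sup>2 / r\<^sup>2 + (1 - (norm (a - h))\<^sup>2 / r\<^sup>2)) - 2 * u\<^sup>2"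
    using tangent[of "1 - (norm (a + h))\<^sup>2 / r\<^sup>2"] tangent[of "1 - (norm (a - h))\<^sup>2 / r\<^sup>2"]
    unfolding bump_def by (simp add: algebra_simps)
  also have "1 - (norm (a + h))\<^sup>2 / r\<^sup>2 + (1 - (norm (a - h))\<^sup>2 / r\<^sup>2)
      = 2 - ((norm (a + h))\<^sup>2 + (norm (a - h))\<^sup>2) / r\<^sup>2"
    by (simp add: add_divide_distrib)
  also have "\<dots> = 2 * u - 2 * ((norm h)\<^sup>2 / r\<^sup>2)"
    unfolding sq u_def by (simp add: add_divide_distrib)
  finally have near: "2 * bump r a - bump r (a + h) - bump r (a - h) \<le> 4 * u * ((norm h)\<^sup>2 / r\<^sup>2)"
    using b(3) by (simp add: algebra_simps power2_eq_square)
  have "u\<^sup>2 \<le> u" using b(2) u1 by (simp add: power2_eq_square mult_left_le)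
  then have far: "2 * bump r a - bump r (a + h) - bump r (a - h) \<le> 4 * u * 1"
    using b bump_nonneg[of r "a + h"] bump_nonneg[of r "a - h"] by simp
  show ?thesis
    using near far unfolding trunc_sq_def min_def by auto
qed

lemma bump_second_difference_at:
  fixes x y z :: "'a::real_inner"
  assumes "0 < bump r (x - z)" "0 < r"
  shows "2 * bump r (x - z) - bump r (y - z) - bump r (2 *\<^sub>R x - y - z)
    \<le> 4 * (1 - (norm (x - z))\<^sup>2 / r\<^sup>2) * trunc_sq r (x - y)"
proof -
  have e: "x - z + (y - x) = y - z" "x - z - (y - x) = 2 *\<^sub>R x - y - z"
    by (simp_all add: scaleR_2)
  have "trunc_sq r (y - x) = trunc_sq r (x - y)" by (simp add: trunc_sq_def norm_minus_commute)
  then show ?thesis using bump_second_difference[OF assms, of "y - x"] unfolding e by simp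
qed

section \<open>Negation of solutions and integral bounds for elliptic kernels\<close>

lemma has_integro_op_uminus:
  assumes "has_integro_op K w x l"
  shows "has_integro_op K (\<lambda>y. - w y) x (- l)"
proof -
  have e: "(- w x - - w y) * K (x - y) = - ((w x - w y) * K (x - y))" for y
    by (simp add: algebra_simps)
  have m: "set_lebesgue_integral lebesgue {y. \<epsilon> < norm (x - y)} (\<lambda>y. - ((w x - w y) * K (x - y)))
    = - set_lebesgue_integral lebesgue {y. \<epsilon> < norm (x - y)} (\<lambda>y. (w x - w y) * K (x - y))" for \<epsilon>
    by (simp add: set_lebesgue_integral_def)
  show ?thesis
    using assms unfolding has_integro_op_def e m
    by (auto intro: tendsto_minus simp: set_integrable_def)
qed

locale elliptic_kernel =
  fixes \<gamma> \<mu> \<Lambda> :: real and K :: "real ^ 'n \<Rightarrow> real"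
  assumes \<gamma>: "0 < \<gamma>" "\<gamma> < 1" and \<mu>: "0 < \<mu>" "\<mu> \<le> \<Lambda>"
    and K: "K \<in> kernel_class \<gamma> \<mu> \<Lambda>"
begin


lemma c_const_pos: "0 < c_const CARD('n) \<gamma>"
  unfolding c_const_def using \<gamma> by (intro mult_pos_pos divide_pos_pos Gamma_real_pos) auto

lemma K_even: "z \<noteq> 0 \<Longrightarrow> K (- z) = K z"
  and K_ge: "z \<noteq> 0 \<Longrightarrow> \<mu> * c_const CARD('n) \<gamma> * norm z powr (- real CARD('n) - 2 * \<gamma>) \<le> K z"
  and K_le: "z \<noteq> 0 \<Longrightarrow> K z \<le> \<Lambda> * c_const CARD('n) \<gamma> * norm z powr (- real CARD('n) - 2 * \<gamma>)"
  using K unfolding kernel_class_def mem_Collect_eq by metis+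

lemma K_pos: "z \<noteq> 0 \<Longrightarrow> 0 < K z"
  using K_ge[of z] \<mu> c_const_pos by (smt (verit) mult_pos_pos powr_gt_zero zero_less_norm_iff)

lemma K_measurable: "(\<lambda>y. K (x - y)) \<in> borel_measurable lebesgue"
proof -
  have "K \<in> borel_measurable lebesgue" using K by (simp add: kernel_class_def)
  from measurable_compose[OF measurable_lebesgue_reflect this] show ?thesis .
qed

lemma trunc_sq_measurable: "(\<lambda>y. trunc_sq r (x - y :: real ^ 'n)) \<in> borel_measurable lebesgue"
proof -
  have "continuous_on UNIV (\<lambda>y. trunc_sq r (x - y :: real ^ 'n))"
    unfolding trunc_sq_def divide_inverse by (intro continuous_intros)
  then show ?thesis
    by (simp add: borel_measurable_continuous_onI measurable_completion)
qed

text \<open>The upper ellipticity bound transfers the estimate for the power kernel to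
  \<open>K\<close>. The unconstrained value \<open>K 0\<close> does no harm because
  \<open>trunc_sq r 0 = 0\<close>.\<close>

lemma integral_trunc_sq_kernel:
  obtains C where "0 < C"
    "\<And>r x. 0 < r \<Longrightarrow> integrable lebesgue (\<lambda>y. trunc_sq r (x - y) * K (x - y))"
    "\<And>r x. 0 < r \<Longrightarrow> (\<integral>y. trunc_sq r (x - y) * K (x - y) \<partial>lebesgue) \<le> C * r powr (- 2 * \<gamma>)"
proof -
  obtain C where C: "0 < C" and le: "\<And>(r::real) (x::real ^ 'n). 0 < r \<Longrightarrow>
    (\<integral>\<^sup>+y. ennreal (trunc_sq r (x - y) * norm (x - y) powr (- real DIM(real ^ 'n) - 2 * \<gamma>)) \<partial>lebesgue)
      \<le> ennreal (C * r powr (- 2 * \<gamma>))"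
    using nn_integral_trunc_sq_powr_le[OF \<gamma>, where 'a = "real ^ 'n"] by blast
  have Lc: "0 < \<Lambda> * c_const CARD('n) \<gamma>" using \<mu> c_const_pos by simp
  have nonneg: "0 \<le> trunc_sq r (x - y) * K (x - y)" for r x y
    using K_pos[of "x - y"] trunc_sq_nonneg[of r "x - y"] by (cases "x = y") (auto simp: trunc_sq_def)
  have bound: "(\<integral>\<^sup>+y. ennreal (trunc_sq r (x - y) * K (x - y)) \<partial>lebesgue)
      \<le> ennreal (\<Lambda> * c_const CARD('n) \<gamma> * C * r powr (- 2 * \<gamma>))" if r: "0 < r" for r x
  proof -
    have "(\<integral>\<^sup>+y. ennreal (trunc_sq r (x - y) * K (x - y)) \<partial>lebesgue)
      \<le> (\<integral>\<^sup>+y. ennreal (\<Lambda> * c_const CARD('n) \<gamma>) * ennreal (trunc_sq r (x - y) * norm (x - y) powr (- real DIM(real ^ 'n) - 2 * \<gamma>)) \<partial>lebesgue)"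
    proof (rule nn_integral_mono)
      fix y
      have "trunc_sq r (x - y) * K (x - y)
        \<le> trunc_sq r (x - y) * (\<Lambda> * c_const CARD('n) \<gamma> * norm (x - y) powr (- real CARD('n) - 2 * \<gamma>))"
        using K_le[of "x - y"] trunc_sq_nonneg[of r "x - y"]
        by (cases "x = y") (auto simp: trunc_sq_def intro: mult_left_mono)
      then show "ennreal (trunc_sq r (x - y) * K (x - y))
        \<le> ennreal (\<Lambda> * c_const CARD('n) \<gamma>) * ennreal (trunc_sq r (x - y) * norm (x - y) powr (- real DIM(real ^ 'n) - 2 * \<gamma>))"
        using Lc trunc_sq_nonneg[of r "x - y"] by (simp add: ennreal_mult'[symmetric] ennreal_leI mult_ac)
    qed
    also have "\<dots> = ennreal (\<Lambda> * c_const CARD('n) \<gamma>) * (\<integral>\<^sup>+y. ennreal (trunc_sq r (x - y) * norm (x - y) powr (- real DIM(real ^ 'n) - 2 * \<gamma>)) \<partial>lebesgue)"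
    proof (rule nn_integral_cmult)
      have "(\<lambda>y. norm (x - y) powr (- real DIM(real ^ 'n) - 2 * \<gamma>)) \<in> borel_measurable lebesgue"
        by (rule measurable_completion) measurable
      then show "(\<lambda>y. ennreal (trunc_sq r (x - y) * norm (x - y) powr (- real DIM(real ^ 'n) - 2 * \<gamma>))) \<in> borel_measurable lebesgue"
        using trunc_sq_measurable[of r x] by measurable
    qed
    also have "\<dots> \<le> ennreal (\<Lambda> * c_const CARD('n) \<gamma>) * ennreal (C * r powr (- 2 * \<gamma>))"
      by (intro mult_left_mono le r) auto
    also have "\<dots> = ennreal (\<Lambda> * c_const CARD('n) \<gamma> * C * r powr (- 2 * \<gamma>))"
      using Lc by (simp add: ennreal_mult'[symmetric] mult_ac)
    finally show ?thesis .
  qed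
  show ?thesis
  proof (rule that[of "\<Lambda> * c_const CARD('n) \<gamma> * C"])
    show "0 < \<Lambda> * c_const CARD('n) \<gamma> * C" using Lc C by simp
    show "integrable lebesgue (\<lambda>y. trunc_sq r (x - y) * K (x - y))" if "0 < r" for r x
    proof (rule integrableI_nonneg)
      show "(\<lambda>y. trunc_sq r (x - y) * K (x - y)) \<in> borel_measurable lebesgue"
        by (intro borel_measurable_times trunc_sq_measurable K_measurable)
      show "(\<integral>\<^sup>+y. ennreal (trunc_sq r (x - y) * K (x - y)) \<partial>lebesgue) < \<infinity>"
        using bound[OF that, of x] by (rule le_less_trans) simp
    qed (use nonneg in auto)
    show "(\<integral>y. trunc_sq r (x - y) * K (x - y) \<partial>lebesgue) \<le> \<Lambda> * c_const CARD('n) \<gamma> * C * r powr (- 2 * \<gamma>)" if "0 < r" for r x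
      using bound[OF that, of x] Lc C by (intro integral_real_bounded) auto
  qed
qed

text \<open>The ball stays at distance \<open>s\<close> from the singularity, so
  \<open>trunc_sq s\<close> is 1 on it and dominates the indicator. The lower bound is the volume of
  the ball times the lower ellipticity bound at the largest distance \<open>t\<close>.\<close>

lemma integral_ball_kernel:
  assumes s: "0 < s" "\<And>y. y \<in> ball p \<rho> \<Longrightarrow> s \<le> norm (x - y)"
    and t: "\<And>y. y \<in> ball p \<rho> \<Longrightarrow> norm (x - y) \<le> t" and \<rho>: "0 < \<rho>"
  shows "integrable lebesgue (\<lambda>y. indicator (ball p \<rho>) y * K (x - y))"
    and "\<mu> * c_const CARD('n) \<gamma> * t powr (- real CARD('n) - 2 * \<gamma>) * (unit_ball_vol (real CARD('n)) * \<rho> ^ CARD('n))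
      \<le> (\<integral>y. indicator (ball p \<rho>) y * K (x - y) \<partial>lebesgue)"
proof -
  obtain C where int: "\<And>r x. 0 < r \<Longrightarrow> integrable lebesgue (\<lambda>y. trunc_sq r (x - y) * K (x - y))"
    using integral_trunc_sq_kernel by blast
  have nz: "x - y \<noteq> 0" if "y \<in> ball p \<rho>" for y using s(1) s(2)[OF that] by auto
  show I: "integrable lebesgue (\<lambda>y. indicator (ball p \<rho>) y * K (x - y))"
  proof (rule Bochner_Integration.integrable_bound[OF int[OF s(1), of x]])
    show "(\<lambda>y. indicator (ball p \<rho>) y * K (x - y)) \<in> borel_measurable lebesgue"
      by (intro borel_measurable_times K_measurable borel_measurable_indicator) auto
    show "AE y in lebesgue. norm (indicator (ball p \<rho>) y * K (x - y)) \<le> norm (trunc_sq s (x - y) * K (x - y))"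
    proof (rule AE_I2)
      fix y
      show "norm (indicator (ball p \<rho>) y * K (x - y)) \<le> norm (trunc_sq s (x - y) * K (x - y))"
      proof (cases "y \<in> ball p \<rho>")
        case True
        then have "s\<^sup>2 \<le> (norm (x - y))\<^sup>2" using s by (intro power_mono) auto
        then have "trunc_sq s (x - y) = 1" using s(1) by (simp add: trunc_sq_def field_simps)
        then show ?thesis using True by simp
      qed simp
    qed
  qed
  define k where "k = \<mu> * c_const CARD('n) \<gamma> * t powr (- real CARD('n) - 2 * \<gamma>)"
  have fin: "ball p \<rho> \<in> lmeasurable" by (rule lmeasurable_ball)
  have vol: "measure lebesgue (ball p \<rho>) = unit_ball_vol (real CARD('n)) * \<rho> ^ CARD('n)"
    using content_ball[of \<rho> p] \<rho> by simp
  have "k * measure lebesgue (ball p \<rho>) = (\<integral>y. indicator (ball p \<rho>) y * k \<partial>lebesgue)"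
    using fin by (simp add: mult.commute)
  also have "\<dots> \<le> (\<integral>y. indicator (ball p \<rho>) y * K (x - y) \<partial>lebesgue)"
  proof (rule integral_mono[OF _ I])
    show "integrable lebesgue (\<lambda>y. indicator (ball p \<rho>) y * k)"
      using fin by (intro integrable_mult_left integrable_real_indicator) (auto simp: fmeasurable_def)
    fix y
    show "indicator (ball p \<rho>) y * k \<le> indicator (ball p \<rho>) y * K (x - y)"
    proof (cases "y \<in> ball p \<rho>")
      case True
      have "t powr (- real CARD('n) - 2 * \<gamma>) \<le> norm (x - y) powr (- real CARD('n) - 2 * \<gamma>)"
        using t[OF True] nz[OF True] \<gamma> by (intro powr_mono2') auto
      then have "k \<le> \<mu> * c_const CARD('n) \<gamma> * norm (x - y) powr (- real CARD('n) - 2 * \<gamma>)"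
        unfolding k_def using \<mu> c_const_pos by (intro mult_left_mono) auto
      then show ?thesis using K_ge[OF nz[OF True]] True by simp
    qed simp
  qed
  finally show "\<mu> * c_const CARD('n) \<gamma> * t powr (- real CARD('n) - 2 * \<gamma>) * (unit_ball_vol (real CARD('n)) * \<rho> ^ CARD('n))
      \<le> (\<integral>y. indicator (ball p \<rho>) y * K (x - y) \<partial>lebesgue)"
    unfolding vol k_def .
qed

lemma integro_op_second_difference_le:
  assumes "has_integro_op K w x l"
    and "\<And>y. y \<noteq> x \<Longrightarrow> 2 * w x - w y - w (2 *\<^sub>R x - y) \<le> G y"
    and "integrable lebesgue (\<lambda>y. G y * K (x - y))"
  shows "2 * l \<le> (\<integral>y. G y * K (x - y) \<partial>lebesgue)"
  using integro_op_le[OF assms(1) K_even _ assms(2,3)] K_pos by (simp add: less_imp_le)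

section \<open>Strong minimum principle and the equation at the supremum\<close>

text \<open>At a zero of \<open>v\<close> all second differences
  \<open>- v y - v (2 *\<^sub>R x - y)\<close> are nonpositive. If \<open>v\<close> were positive
  somewhere, they would be bounded away from 0 on a ball, where \<open>K\<close> has positive mass,
  and the operator would be negative at \<open>x\<close>.\<close>

lemma strong_minimum_principle:
  assumes cont: "continuous_on UNIV v" and nonneg: "\<And>y. 0 \<le> v y"
    and op: "has_integro_op K v x 0" and zero: "v x = 0"
  shows "v y = 0"
proof (rule ccontr)
  assume "v y \<noteq> 0"
  then have pos: "0 < v y" using nonneg[of y] by simp
  then have ne: "y \<noteq> x" using zero by auto
  obtain d where d: "0 < d" "\<And>y'. dist y' y < d \<Longrightarrow> dist (v y') (v y) < v y / 2"
    using cont pos unfolding continuous_on_iff by (metis UNIV_I half_gt_zero)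
  \<comment> \<open>The second bound keeps the ball at distance at least \<open>dist x y / 2\<close>
    from the singularity at \<open>x\<close>.\<close>
  define \<rho> where "\<rho> = min d (dist x y / 2)"
  have \<rho>: "0 < \<rho>" using d ne by (simp add: \<rho>_def)
  have s: "dist x y / 2 \<le> norm (x - y')" "norm (x - y') \<le> 2 * dist x y" if "y' \<in> ball y \<rho>" for y'
    using that dist_triangle[of x y y'] dist_triangle[of x y' y]
    unfolding \<rho>_def dist_norm[symmetric] by (auto simp: dist_commute)
  have s0: "0 < dist x y / 2" using ne by simp
  note B = integral_ball_kernel[where p = y and \<rho> = \<rho>, OF s0 s \<rho>]
  have "2 * 0 \<le> (\<integral>y'. (- v y / 2 * indicator (ball y \<rho>) y') * K (x - y') \<partial>lebesgue)"
  proof (rule integro_op_second_difference_le[OF op])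
    have "v y / 2 < v y'" if "y' \<in> ball y \<rho>" for y'
      using d(2)[of y'] that unfolding \<rho>_def dist_real_def
      by (simp add: dist_commute) (smt (verit) field_sum_of_halves)
    then show "2 * v x - v y' - v (2 *\<^sub>R x - y') \<le> - v y / 2 * indicator (ball y \<rho>) y'" for y'
      using nonneg[of y'] nonneg[of "2 *\<^sub>R x - y'"] zero
      by (cases "y' \<in> ball y \<rho>") (fastforce simp: indicator_def)+
    show "integrable lebesgue (\<lambda>y'. (- v y / 2 * indicator (ball y \<rho>) y') * K (x - y'))"
      unfolding mult.assoc by (intro integrable_mult_right B(1))
  qed
  also have "\<dots> = - v y / 2 * (\<integral>y'. indicator (ball y \<rho>) y' * K (x - y') \<partial>lebesgue)"
    by (simp only: mult.assoc integral_mult_right_zero)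
  also have "\<dots> < 0"
  proof -
    have "0 < \<mu> * c_const CARD('n) \<gamma> * (2 * dist x y) powr (- real CARD('n) - 2 * \<gamma>) * (unit_ball_vol (real CARD('n)) * \<rho> ^ CARD('n))"
      using \<mu> c_const_pos \<rho> ne by simp
    also note B(2)
    finally show ?thesis using pos by (simp add: mult_neg_pos)
  qed
  finally show False by simp
qed

text \<open>The supremum need not be attained, so a bump of height \<delta> is added at an almost
  maximal point \<open>p\<close>. The sum has a maximum point \<open>x\<close>, where
  \<open>w x\<close> is within \<delta> of the supremum and the operator is at least a negative
  multiple of \<delta>. A general \<open>g\<close> is allowed so that the result also applies to
  \<open>- v\<close>.\<close>

lemma nonneg_at_Sup:
  assumes cont: "continuous_on UNIV w" and bdd: "bdd_above (range w)"
    and op: "\<And>x. has_integro_op K w x (g (w x))" and g: "isCont g (SUP x. w x)"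
  shows "0 \<le> g (SUP x. w x)"
proof (rule ccontr)
  define M where "M = (SUP x. w x)"
  assume "\<not> ?thesis"
  then have neg: "g M < 0" by (simp add: M_def)
  obtain C where C: "0 < C"
    and int: "\<And>r x. 0 < r \<Longrightarrow> integrable lebesgue (\<lambda>y. trunc_sq r (x - y) * K (x - y))"
    and le: "\<And>r x. 0 < r \<Longrightarrow> (\<integral>y. trunc_sq r (x - y) * K (x - y) \<partial>lebesgue) \<le> C * r powr (- 2 * \<gamma>)"
    using integral_trunc_sq_kernel by blast
  obtain \<eta> where \<eta>: "0 < \<eta>" "\<And>t. dist t M < \<eta> \<Longrightarrow> dist (g t) (g M) < - g M / 2"
    using g neg unfolding continuous_at_eps_delta M_def[symmetric] dist_real_def
    by (metis half_gt_zero neg_0_less_iff_less)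
  \<comment> \<open>The first bound will give \<open>g (w x) < g M / 2\<close>; the second makes the
    error \<open>4 * \<delta> * C\<close> at most \<open>- g M\<close>. Together they are
    contradictory.\<close>
  define \<delta> where "\<delta> = min \<eta> (- g M / (4 * C))"
  have \<delta>: "0 < \<delta>" "\<delta> \<le> \<eta>" "\<delta> * (4 * C) \<le> - g M"
  proof -
    have "\<delta> \<le> - g M / (4 * C)" by (simp add: \<delta>_def)
    then show "\<delta> * (4 * C) \<le> - g M" using C by (simp add: field_simps)
  qed (use \<eta> neg C in \<open>auto simp: \<delta>_def divide_neg_pos\<close>)
  have wM: "w y \<le> M" for y unfolding M_def using bdd by (rule cSUP_upper[rotated]) simp
  obtain p where p: "M - \<delta> < w p"
    using less_cSUP_iff[of UNIV w "M - \<delta>"] bdd \<delta> unfolding M_def by auto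
  define h where "h = (\<lambda>y. w y + \<delta> * bump 1 (y - p))"
  have "\<exists>x\<in>cball p 1. \<forall>y\<in>cball p 1. h y \<le> h x"
    unfolding h_def using cont
    by (intro continuous_attains_sup continuous_intros continuous_on_bump) (auto intro: continuous_on_subset)
  then obtain x where x: "x \<in> cball p 1" "\<And>y. y \<in> cball p 1 \<Longrightarrow> h y \<le> h x" by auto
  have "h p \<le> h x" using x(2)[of p] by simp
  then have px: "w p + \<delta> \<le> w x + \<delta> * bump 1 (x - p)" by (simp add: h_def bump_zero)
  then have "0 < \<delta> * bump 1 (x - p)" using p wM[of x] by simp
  then have bx: "0 < bump 1 (x - p)" using \<delta> by (simp add: zero_less_mult_iff)
  \<comment> \<open>The maximum over the closed ball is global: outside it the bump vanishes and
    \<open>h y = w y \<le> M < w p + \<delta> = h p\<close>.\<close>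
  have hx: "h y \<le> h x" for y
  proof (cases "y \<in> cball p 1")
    case True
    then show ?thesis by (rule x)
  next
    case False
    then have "1 < norm (y - p)" by (simp add: dist_norm norm_minus_commute)
    then have "1 \<le> (norm (y - p))\<^sup>2" by (simp add: one_le_power)
    then have "h y = w y" by (simp add: h_def bump_def)
    then have "h y < w p + \<delta>" using wM[of y] p by simp
    also have "\<dots> \<le> h x" using px by (simp add: h_def)
    finally show ?thesis by simp
  qed
  have "\<delta> * bump 1 (x - p) \<le> \<delta> * 1" using \<delta> bump_le_1 by (intro mult_left_mono) auto
  then have wx: "M - \<delta> < w x" using p px by simp
  have "dist (w x) M < \<eta>" using wx wM[of x] \<delta> by (simp add: dist_real_def)
  from \<eta>(2)[OF this] have gx: "g (w x) < g M / 2" by (simp add: dist_real_def)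
  \<comment> \<open>Since \<open>h\<close> is maximal at \<open>x\<close>, second differences of
    \<open>- w\<close> there are at most \<delta> times those of the bump. The degenerate factor may
    be replaced by 1 here.\<close>
  have "2 * (- g (w x)) \<le> (\<integral>y. (4 * \<delta> * trunc_sq 1 (x - y)) * K (x - y) \<partial>lebesgue)"
  proof (rule integro_op_second_difference_le[OF has_integro_op_uminus[OF op]])
    fix y
    have "2 * - w x - - w y - - w (2 *\<^sub>R x - y)
      \<le> \<delta> * (2 * bump 1 (x - p) - bump 1 (y - p) - bump 1 (2 *\<^sub>R x - y - p))"
      using hx[of y] hx[of "2 *\<^sub>R x - y"] by (simp add: h_def algebra_simps)
    also have "\<dots> \<le> \<delta> * (4 * (1 - (norm (x - p))\<^sup>2 / 1\<^sup>2) * trunc_sq 1 (x - y))"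
      using \<delta> by (intro mult_left_mono bump_second_difference_at bx) auto
    also have "\<dots> \<le> \<delta> * (4 * 1 * trunc_sq 1 (x - y))"
      using \<delta> trunc_sq_nonneg by (intro mult_left_mono mult_right_mono) auto
    finally show "2 * - w x - - w y - - w (2 *\<^sub>R x - y) \<le> 4 * \<delta> * trunc_sq 1 (x - y)"
      by (simp add: mult_ac)
    show "integrable lebesgue (\<lambda>y. (4 * \<delta> * trunc_sq 1 (x - y)) * K (x - y))"
      unfolding mult.assoc by (intro integrable_mult_right int) simp
  qed
  also have "\<dots> = 4 * \<delta> * (\<integral>y. trunc_sq 1 (x - y) * K (x - y) \<partial>lebesgue)"
    by (simp only: mult.assoc integral_mult_right_zero)
  also have "\<dots> \<le> 4 * \<delta> * C"
    using le[of 1 x] \<delta> by (intro mult_left_mono) auto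
  also have "\<dots> \<le> - g M" using \<delta>(3) by (simp add: mult_ac)
  finally show False using gx by simp
qed

section \<open>Touching bumps and a uniform positive lower bound\<close>

text \<open>The largest multiple of a bump of radius \<open>R\<close> lying below \<open>v\<close> touches it at a point where
  \<open>L\<^sub>K v \<le> C R powr (- 2 * \<gamma>) v\<close>. Near the edge of the support, where the second difference is only bounded by
  \<open>u\<close>, the mass of the bump on a ball at distance comparable to \<open>R\<close> compensates, by AM-GM.\<close>

lemma touching_bump:
  obtains C where "0 < C"
    "\<And>v l R x z e. \<lbrakk>0 < R; has_integro_op K v x l; 0 < e; 0 < bump R (x - z);
      v x = e * bump R (x - z); \<And>y. e * bump R (y - z) \<le> v y\<rbrakk> \<Longrightarrow> l \<le> C * R powr (- 2 * \<gamma>) * v x"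
proof -
  obtain C0 where C0: "0 < C0"
    and int: "\<And>r x. 0 < r \<Longrightarrow> integrable lebesgue (\<lambda>y. trunc_sq r (x - y) * K (x - y))"
    and le: "\<And>r x. 0 < r \<Longrightarrow> (\<integral>y. trunc_sq r (x - y) * K (x - y) \<partial>lebesgue) \<le> C0 * r powr (- 2 * \<gamma>)"
    using integral_trunc_sq_kernel by blast
  define n where "n = CARD('n)"
  \<comment> \<open>The lower bound for the kernel mass of a ball of radius \<open>R / 8\<close>
    within distance \<open>2 * R\<close> of \<open>x\<close>, with the scaling factor
    \<open>R powr (- 2 * \<gamma>)\<close> removed.\<close>
  define c where "c = \<mu> * c_const n \<gamma> * 2 powr (- real n - 2 * \<gamma>) * (unit_ball_vol (real n) * (1 / 8) ^ n)"
  have c: "0 < c" using \<mu> c_const_pos by (simp add: c_def n_def)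
  \<comment> \<open>The constant that comes out of expanding
    \<open>(16 * u * C0 - c / 2)\<^sup>2 \<ge> 0\<close> in the final estimate.\<close>
  define C where "C = 128 * C0\<^sup>2 / c"
  show thesis
  proof (rule that[of C])
    show "0 < C" using C0 c by (simp add: C_def)
    fix v :: "real ^ 'n \<Rightarrow> real" and l R x z e
    assume R: "0 < R" and op: "has_integro_op K v x l" and e: "0 < e"
      and bx: "0 < bump R (x - z)" and touch: "v x = e * bump R (x - z)"
      and below: "\<And>y. e * bump R (y - z) \<le> v y"
    define u where "u = 1 - (norm (x - z))\<^sup>2 / R\<^sup>2"
    note b = bump_pos_imp[OF bx R, folded u_def]
    have u1: "u \<le> 1" by (simp add: u_def)
    \<comment> \<open>The direction \<open>i\<close> from \<open>z\<close> to \<open>p\<close> makes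
      no acute angle with \<open>x - z\<close>. The ball of radius \<open>R / 8\<close> about
      \<open>p\<close> is then far from \<open>x\<close>, yet well inside the support of the
      bump.\<close>
    obtain p where p: "norm (p - z) = R / 2" "R / 2 \<le> norm (x - p)"
    proof -
      obtain i :: "real ^ 'n" where i: "norm i = 1" "i \<bullet> (x - z) \<le> 0"
      proof -
        obtain j :: "real ^ 'n" where j: "norm j = 1" using vector_choose_size[of 1] by auto
        show thesis
          by (cases "j \<bullet> (x - z) \<le> 0") (use that[of j] that[of "- j"] j in auto)
      qed
      have "(R / 2)\<^sup>2 \<le> (norm (x - z))\<^sup>2 - R * (i \<bullet> (x - z)) + (R / 2)\<^sup>2"
        using mult_nonneg_nonpos[of R "i \<bullet> (x - z)"] R i(2) zero_le_power2[of "norm (x - z)"] by linarith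
      also have "\<dots> = (norm (x - (z + (R / 2) *\<^sub>R i)))\<^sup>2"
      proof -
        have "x - (z + (R / 2) *\<^sub>R i) = (x - z) - (R / 2) *\<^sub>R i" by simp
        moreover have "i \<bullet> i = 1" using i(1) by (simp add: norm_eq_1)
        ultimately show ?thesis
          unfolding power2_norm_eq_inner
          by (simp only: inner_diff_left[of "x - z"] inner_diff_right[of _ "x - z"])
            (simp add: inner_commute power2_eq_square)
      qed
      finally have "R / 2 \<le> norm (x - (z + (R / 2) *\<^sub>R i))"
        by (rule power2_le_imp_le) simp
      then show thesis using that[of "z + (R / 2) *\<^sub>R i"] i R by simp
    qed
    define D where "D = ball p (R / 8)"
    have D1: "3 * R / 8 \<le> norm (x - y)" "norm (x - y) \<le> 2 * R" "norm (y - z) \<le> 5 * R / 8" if "y \<in> D" for y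
    proof -
      have py: "norm (p - y) < R / 8" using that by (simp add: D_def dist_norm)
      show yz: "norm (y - z) \<le> 5 * R / 8"
        using norm_triangle_ineq[of "y - p" "p - z"] py p by (simp add: norm_minus_commute)
      show "3 * R / 8 \<le> norm (x - y)"
        using norm_triangle_ineq[of "x - y" "y - p"] py p by (simp add: norm_minus_commute)
      show "norm (x - y) \<le> 2 * R"
        using norm_triangle_ineq[of "x - z" "z - y"] yz b(1) R by (simp add: norm_minus_commute)
    qed
    have Rp: "0 < 3 * R / 8" "0 < R / 8" using R by auto
    note B = integral_ball_kernel[where p = p and \<rho> = "R / 8", folded D_def, OF Rp(1) D1(1,2) Rp(2)]
    \<comment> \<open>Enlarging the coefficient 4 of the second-difference bound to 16 makes room on
      \<open>D\<close>: there \<open>trunc_sq\<close> is at least 9/64, so the first term alone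
      covers \<open>2 * bump R (x - z)\<close>. The value of the bump at \<open>y\<close>, at least
      1/4, can then be subtracted.\<close>
    define G where "G = (\<lambda>y. e * (16 * u * trunc_sq R (x - y) - 1 / 4 * indicator D y))"
    have GK: "G y * K (x - y) = e * (16 * u) * (trunc_sq R (x - y) * K (x - y)) - e / 4 * (indicator D y * K (x - y))" for y
      by (simp add: G_def algebra_simps)
    have "2 * l \<le> (\<integral>y. G y * K (x - y) \<partial>lebesgue)"
    proof (rule integro_op_second_difference_le[OF op])
      show "integrable lebesgue (\<lambda>y. G y * K (x - y))"
        unfolding GK by (intro Bochner_Integration.integrable_diff integrable_mult_right int B(1) R)
      fix y
      have "2 * v x - v y - v (2 *\<^sub>R x - y)
        \<le> e * (2 * bump R (x - z) - bump R (y - z) - bump R (2 *\<^sub>R x - y - z))"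
        using below[of y] below[of "2 *\<^sub>R x - y"] touch by (simp add: algebra_simps)
      also have "\<dots> \<le> G y"
      proof -
        have "2 * bump R (x - z) - bump R (y - z) - bump R (2 *\<^sub>R x - y - z)
          \<le> 16 * u * trunc_sq R (x - y) - 1 / 4 * indicator D y"
        proof (cases "y \<in> D")
          case True
          have "(norm (y - z))\<^sup>2 \<le> (5 * R / 8)\<^sup>2" using D1(3)[OF True] by (intro power_mono) auto
          then have "(norm (y - z))\<^sup>2 / R\<^sup>2 \<le> 25 / 64" using R by (simp add: field_simps power2_eq_square)
          then have "1 / 2 \<le> max 0 (1 - (norm (y - z))\<^sup>2 / R\<^sup>2)" by linarith
          then have "(1 / 2)\<^sup>2 \<le> bump R (y - z)" unfolding bump_def by (rule power_mono) simp
          then have by4: "1 / 4 \<le> bump R (y - z)" by (simp add: power2_eq_square)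
          have "(3 * R / 8)\<^sup>2 \<le> (norm (x - y))\<^sup>2" using D1(1)[OF True] R by (intro power_mono) auto
          then have "9 / 64 \<le> trunc_sq R (x - y)"
            unfolding trunc_sq_def using R by (simp add: field_simps power2_eq_square)
          then have "16 * u * (9 / 64) \<le> 16 * u * trunc_sq R (x - y)"
            using b by (intro mult_left_mono) auto
          moreover have "bump R (x - z) \<le> u" using b u1 by (simp add: power2_eq_square mult_left_le)
          ultimately have "2 * bump R (x - z) \<le> 16 * u * trunc_sq R (x - y)" using b by linarith
          then show ?thesis using True by4 bump_nonneg[of R "2 *\<^sub>R x - y - z"] by simp
        next
          case False
          have "2 * bump R (x - z) - bump R (y - z) - bump R (2 *\<^sub>R x - y - z) \<le> 4 * u * trunc_sq R (x - y)"
            unfolding u_def by (rule bump_second_difference_at[OF bx R])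
          also have "\<dots> \<le> 16 * u * trunc_sq R (x - y)"
            using b trunc_sq_nonneg[of R "x - y"] by (intro mult_right_mono) auto
          finally show ?thesis using False by simp
        qed
        then show ?thesis unfolding G_def using e by (intro mult_left_mono) auto
      qed
      finally show "2 * v x - v y - v (2 *\<^sub>R x - y) \<le> G y" .
    qed
    also have "\<dots> = e * (16 * u) * (\<integral>y. trunc_sq R (x - y) * K (x - y) \<partial>lebesgue)
        - e / 4 * (\<integral>y. indicator D y * K (x - y) \<partial>lebesgue)"
      unfolding GK by (simp only: Bochner_Integration.integral_diff integral_mult_right_zero
          integrable_mult_right int B(1) R)
    also have "\<dots> \<le> e * (16 * u) * (C0 * R powr (- 2 * \<gamma>)) - e / 4 * (c * R powr (- 2 * \<gamma>))"
    proof (intro diff_mono mult_left_mono le R)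
      have "c * R powr (- 2 * \<gamma>) = \<mu> * c_const CARD('n) \<gamma> * (2 * R) powr (- real CARD('n) - 2 * \<gamma>)
        * (unit_ball_vol (real CARD('n)) * (R / 8) ^ CARD('n))"
      proof -
        have "R powr (- real n - 2 * \<gamma>) * R ^ n = R powr (- 2 * \<gamma>)"
          using R by (simp add: powr_realpow[symmetric] powr_add[symmetric])
        then have "c * R powr (- 2 * \<gamma>) = c * (R powr (- real n - 2 * \<gamma>) * R ^ n)" by simp
        then show ?thesis
          using R by (simp add: c_def n_def powr_mult power_divide)
      qed
      also note B(2)
      finally show "c * R powr (- 2 * \<gamma>) \<le> (\<integral>y. indicator D y * K (x - y) \<partial>lebesgue)" .
    qed (use e b in auto)
    also have "\<dots> = e * R powr (- 2 * \<gamma>) * (16 * u * C0 - c / 4)"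
      by (simp add: algebra_simps)
    also have "\<dots> \<le> e * R powr (- 2 * \<gamma>) * (2 * C * u\<^sup>2)"
    proof (intro mult_left_mono)
      \<comment> \<open>This trades the factor \<open>u\<close> for \<open>u\<^sup>2\<close>, the
        value of the bump at \<open>x\<close>; the mass term \<open>c / 4\<close> pays for
        it.\<close>
      have "0 \<le> (16 * u * C0 - c / 2)\<^sup>2" by simp
      then have "c * (16 * u * C0 - c / 4) \<le> c * (2 * C * u\<^sup>2)"
        using c by (simp add: C_def power2_eq_square algebra_simps)
      then show "16 * u * C0 - c / 4 \<le> 2 * C * u\<^sup>2" using c by simp
    qed (use e in auto)
    also have "\<dots> = 2 * (C * R powr (- 2 * \<gamma>) * v x)"
      using touch b(3) by simp
    finally show "l \<le> C * R powr (- 2 * \<gamma>) * v x" by simp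
  qed
qed

lemma lower_bound_of_positive_solution:
  assumes cont: "continuous_on UNIV v" and pos: "\<And>y. 0 < v y"
    and op: "\<And>x. has_integro_op K v x (f (v x))"
    and s: "0 < s" and f: "\<And>t. \<lbrakk>0 < t; t < t0\<rbrakk> \<Longrightarrow> s * t \<le> f t"
  shows "t0 \<le> v z"
proof -
  obtain C where C: "0 < C" and C_le: "\<And>v l R x z e. \<lbrakk>0 < R; has_integro_op K v x l; 0 < e;
      0 < bump R (x - z); v x = e * bump R (x - z); \<And>y. e * bump R (y - z) \<le> v y\<rbrakk>
      \<Longrightarrow> l \<le> C * R powr (- 2 * \<gamma>) * v x"
    using touching_bump by blast
  \<comment> \<open>Solves \<open>C * R powr (- 2 * \<gamma>) = s / 2\<close>, half the growth rate
    of \<open>f\<close> at small values. \<open>R\<close> does not depend on \<open>z\<close>, hence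
    neither does the lower bound.\<close>
  define R where "R = (s / (2 * C)) powr (- 1 / (2 * \<gamma>))"
  have R: "0 < R" using s C by (simp add: R_def)
  have CR: "C * R powr (- 2 * \<gamma>) = s / 2"
    using s C \<gamma> by (simp add: R_def powr_powr)
  have sub: "continuous_on S v" for S using cont by (rule continuous_on_subset) simp
  obtain q where q: "q \<in> cball z R" "\<And>y. y \<in> cball z R \<Longrightarrow> v q \<le> v y"
    using continuous_attains_inf[OF compact_cball _ sub, of z R] R by auto
  \<comment> \<open>The quotient of \<open>v\<close> by the bump is to be minimised, but the bump
    vanishes at the edge of the ball. On the compact set \<open>S\<close> it is bounded below.
    Elsewhere in the ball \<open>e \<le> v z\<close> gives
    \<open>e * bump R (y - z) < v q \<le> v y\<close>, so the minimum over \<open>S\<close>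
    suffices.\<close>
  define S where "S = cball z R \<inter> {y. v q / v z \<le> bump R (y - z)}"
  have "closed {y. v q / v z \<le> bump R (y - z)}"
    using R by (intro closed_Collect_le continuous_on_bump continuous_intros) auto
  then have S: "compact S" unfolding S_def by (rule compact_Int_closed[OF compact_cball])
  have qz: "v q \<le> v z" using q(2)[of z] R by simp
  then have zS: "z \<in> S" using R pos[of z] by (simp add: S_def bump_zero)
  have bS: "0 < bump R (y - z)" if "y \<in> S" for y
    using that divide_pos_pos[OF pos[of q] pos[of z]] unfolding S_def by auto
  have "continuous_on S (\<lambda>y. v y / bump R (y - z))"
    using bS R by (intro continuous_on_divide sub continuous_on_bump) force+
  from continuous_attains_inf[OF S _ this] zS
  obtain x where x: "x \<in> S" "\<And>y. y \<in> S \<Longrightarrow> v x / bump R (x - z) \<le> v y / bump R (y - z)"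
    by auto
  define e where "e = v x / bump R (x - z)"
  have e: "0 < e" using pos[of x] bS[OF x(1)] by (simp add: e_def)
  have ez: "e \<le> v z" using x(2)[OF zS] by (simp add: e_def bump_zero)
  have touch: "v x = e * bump R (x - z)" using bS[OF x(1)] by (simp add: e_def)
  have below: "e * bump R (y - z) \<le> v y" for y
  proof (cases "0 < bump R (y - z)")
    case False
    then have "bump R (y - z) = 0" using bump_nonneg[of R "y - z"] by linarith
    then show ?thesis using pos[of y] by simp
  next
    case True
    then have yc: "y \<in> cball z R"
      using bump_pos_imp(1)[OF True R] by (simp add: dist_norm norm_minus_commute)
    show ?thesis
    proof (cases "y \<in> S")
      case True
      then show ?thesis using x(2)[OF True] bS[OF True] by (simp add: e_def field_simps)
    next
      case False
      then have "bump R (y - z) * v z < v q" using yc pos[of z] by (simp add: S_def field_simps)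
      moreover have "e * bump R (y - z) \<le> v z * bump R (y - z)"
        using ez bump_nonneg by (rule mult_right_mono)
      ultimately show ?thesis using q(2)[OF yc] by (simp add: mult.commute)
    qed
  qed
  have "f (v x) \<le> s / 2 * v x"
    using C_le[OF R op e bS[OF x(1)] touch below] unfolding CR .
  also have "\<dots> < s * v x" using s pos[of x] by simp
  finally have "t0 \<le> v x" using f[of "v x"] pos[of x] by (smt (verit))
  also have "\<dots> \<le> e" unfolding touch using e bump_le_1[of R "x - z"] by (simp add: mult_left_le)
  finally show ?thesis using ez by simp
qed

end

section \<open>The dichotomy between the constants 0 and 1\<close>

theorem theorem1p5:
  fixes \<gamma> \<mu> \<Lambda> :: real
    and K :: "real ^ 'n \<Rightarrow> real"
    and f :: "real \<Rightarrow> real"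
    and v :: "real ^ 'n \<Rightarrow> real"
  assumes "0 < \<gamma>" and "\<gamma> < 1"
    and "0 < \<mu>" and "\<mu> \<le> \<Lambda>"
    and "K \<in> kernel_class \<gamma> \<mu> \<Lambda>"
    and "bounded (range v)"
    and "classical_solution K f v"
    and "\<forall>x. 0 \<le> v x"
    and "f C1_differentiable_on UNIV"
    and "f 0 = 0" and "f 1 = 0"
    and "deriv f 0 > 0"
    and "\<forall>t. 0 < t \<and> t < 1 \<longrightarrow> f t > 0"
    and "\<forall>t>1. f t < 0"
  shows "(\<forall>x. v x = 0) \<or> (\<forall>x. v x = 1)"
proof -
  interpret elliptic_kernel \<gamma> \<mu> \<Lambda> K using assms by unfold_locales
  have cont: "continuous_on UNIV v" and op: "\<And>x. has_integro_op K v x (f (v x))"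
    using assms(7) unfolding classical_solution_def by auto
  have diff: "f differentiable at t" for t
    using assms(9) by (simp add: C1_differentiable_on_eq)
  have fcont: "isCont f t" for t
    using diff by (rule differentiable_imp_continuous_within)
  show ?thesis
  proof (cases "\<exists>x. v x = 0")
    case True
    then obtain x where x: "v x = 0" by blast
    then have "has_integro_op K v x 0" using op[of x] assms(10) by simp
    then show ?thesis using strong_minimum_principle[OF cont _ _ x] assms(8) by blast
  next
    case False
    then have pos: "0 < v y" for y using assms(8) by (metis order_less_le)
    \<comment> \<open>Since \<open>f 0 = 0\<close>, the quotient \<open>f t / t\<close> tends to
      \<open>deriv f 0 > 0\<close>, so it exceeds half this limit near 0.\<close>
    obtain t0 where t0: "0 < t0" "\<And>t. \<lbrakk>0 < t; t < t0\<rbrakk> \<Longrightarrow> deriv f 0 / 2 * t \<le> f t"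
    proof -
      have "(f has_real_derivative deriv f 0) (at 0)"
        using diff[of 0] by (metis DERIV_imp_deriv real_differentiable_def)
      then have "((\<lambda>t. f t / t) \<longlongrightarrow> deriv f 0) (at 0)"
        using assms(10) by (simp add: has_field_derivative_iff)
      then have "\<forall>\<^sub>F t in at 0. deriv f 0 / 2 < f t / t"
        using assms(12) by (intro order_tendstoD) auto
      then obtain d where d: "0 < d" "\<And>t. \<lbrakk>t \<noteq> 0; dist t 0 < d\<rbrakk> \<Longrightarrow> deriv f 0 / 2 < f t / t"
        unfolding eventually_at by auto
      show thesis
      proof (rule that[OF d(1)])
        fix t assume "0 < t" "t < d"
        then show "deriv f 0 / 2 * t \<le> f t" using d(2)[of t] by (simp add: field_simps)
      qed
    qed
    have lower: "t0 \<le> v z" for z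
      using lower_bound_of_positive_solution[OF cont pos op _ t0(2)] assms(12) by simp
    have above: "bdd_above (range v)" and below: "bdd_below (range v)"
      using assms(6) by (auto intro: bounded_imp_bdd_above bounded_imp_bdd_below)
    define M m where "M = (SUP x. v x)" and "m = (INF x. v x)"
    have vM: "v x \<le> M" and mv: "m \<le> v x" for x
      unfolding M_def m_def using above below by (auto intro: cSUP_upper cINF_lower)
    have "0 \<le> f M"
      unfolding M_def by (rule nonneg_at_Sup[OF cont above op fcont])
    then have M: "M \<le> 1" using assms(14) by (meson linorder_not_less)
    have m_eq: "(SUP x. - v x) = - m"
      unfolding m_def Inf_real_def by (simp add: image_image)
    \<comment> \<open>\<open>- v\<close> solves the equation with nonlinearity
      \<open>\<lambda>t. - f (- t)\<close>, so the statement at the supremum becomes one at the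
      infimum of \<open>v\<close>.\<close>
    have "0 \<le> - f (- (SUP x. - v x))"
    proof (rule nonneg_at_Sup[where w = "\<lambda>x. - v x" and g = "\<lambda>t. - f (- t)"])
      show "continuous_on UNIV (\<lambda>x. - v x)" using cont by (intro continuous_intros)
      show "bdd_above (range (\<lambda>x. - v x))"
        using below by (metis bdd_above_uminus image_image)
      show "has_integro_op K (\<lambda>x. - v x) x (- f (- (- v x)))" for x
        using has_integro_op_uminus[OF op[of x]] by simp
      show "isCont (\<lambda>t. - f (- t)) (SUP x. - v x)"
        by (intro continuous_minus isCont_o2[OF _ fcont]) auto
    qed
    then have "f m \<le> 0" by (simp add: m_eq)
    \<comment> \<open>The uniform lower bound enters here: \<open>f m \<le> 0\<close> alone would
      leave \<open>m = 0\<close> possible.\<close>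
    moreover have "0 < m"
      using t0(1) lower cINF_greatest[of UNIV t0 v] unfolding m_def by force
    ultimately have "1 \<le> m" using assms(13) by (meson linorder_not_less)
    then show ?thesis using vM mv M by (meson order.trans order.antisym)
  qed
qed

end
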